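(* Let $a_1,a_2,b_1,b_2,\gamma_1,\gamma_2,\gamma_3\in\mathbb{C}$ with $c=a_1b_2-a_2b_1\ne0$, let $c_{n\ell}$ ($n=1,2$; $\ell=1,2,3,4$) be the coefficients determined by these parameters as in the context, let $u_1,u_2,u_3$ be the roots, assumed pairwise distinct, of $u^3+\gamma_1u^2+(\gamma_2-1)u+\gamma_3$, and assume that the three numbers $\lambda_j=\Big[\prod_{\ell\neq j}(u_j-u_\ell)\Big]^{-1}$, $j=1,2,3$, are rational. Let $\omega$ be a nonzero real number and $\tilde T=2\pi/|\omega|$. Then the system $$\dot{\tilde x}_n=\mathbf{i}\omega\tilde x_n+c_{n1}\tilde x_1^3+c_{n2}\tilde x_1^2\tilde x_2+c_{n3}\tilde x_1\tilde x_2^2+c_{n4}\tilde x_2^3,\qquad n=1,2,$$ is isochronous: there is a positive integer $N$, independent of the initial data, such that for all generic initial data $(\tilde x_1(0),\tilde x_2(0))\in\mathbb{C}^2$ (in the sense of the context) the solution $(\tilde x_1(t),\tilde x_2(t))$ exists for all real $t$ and satisfies $$\tilde x_n(t+N\tilde T)=\tilde x_n(t)\qquad\text{for all }t\in\mathbb{R},\ n=1,2.$$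
   Context: Here $\mathbf{i}$ is the imaginary unit and the independent variable $t$ is real, the unknowns being complex-valued. The coefficients $c_{n\ell}$ are defined by $$c_{11}=\frac{a_1^3b_2-a_2K_1}{c},\quad c_{21}=\frac{-a_1^3b_1+a_1K_1}{c},\quad c_{12}=\frac{3a_1^2a_2b_2-a_2K_2}{c},\quad c_{22}=\frac{-3a_1^2a_2b_1+a_1K_2}{c},$$ $$c_{13}=\frac{3a_1a_2^2b_2-a_2K_3}{c},\quad c_{23}=\frac{-3a_1a_2^2b_1+a_1K_3}{c},\quad c_{14}=\frac{a_2^3b_2-a_2K_4}{c},\quad c_{24}=\frac{-a_2^3b_1+a_1K_4}{c},$$ with $$K_1=\gamma_1a_1b_1^2+\gamma_2a_1^2b_1+\gamma_3a_1^3+b_1^3,$$ $$K_2=\gamma_1(a_2b_1^2+2a_1b_1b_2)+\gamma_2(a_1^2b_2+2a_1a_2b_1)+3\gamma_3a_1^2a_2+3b_1^2b_2,$$ $$K_3=\gamma_1(a_1b_2^2+2a_2b_1b_2)+\gamma_2(a_2^2b_1+2a_1a_2b_2)+3\gamma_3a_1a_2^2+3b_1b_2^2,$$ $$K_4=\gamma_1a_2b_2^2+\gamma_2a_2^2b_2+\gamma_3a_2^3+b_2^3.$$ Generic initial data: given $(\tilde x_1(0),\tilde x_2(0))$, let $(x_1(\tau),x_2(\tau))$ be the holomorphic solution near $\tau=0$ of the homogeneous system $\frac{dx_n}{d\tau}=c_{n1}x_1^3+c_{n2}x_1^2x_2+c_{n3}x_1x_2^2+c_{n4}x_2^3$ ($n=1,2$)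 with $x_n(0)=\tilde x_n(0)$. The initial data are called generic if, with $y(0)=a_1x_1(0)+a_2x_2(0)$ and $w(0)=b_1x_1(0)+b_2x_2(0)$, one has $y(0)\ne0$, $w(0)/y(0)\notin\{u_1,u_2,u_3\}$, and the germs at $\tau=0$ of $x_1,x_2$ can be analytically continued along the whole path $t\mapsto\tau(t)=\frac{e^{2\mathbf{i}\omega t}-1}{2\mathbf{i}\omega}$, $t\in\mathbb{R}$ (which winds around the circle of radius $1/(2|\omega|)$ centred at $\mathbf{i}/(2\omega)$), i.e. no singularity is met on that circle. *)

theory Defs
  imports "HOL-Complex_Analysis.Complex_Analysis"
begin

(* Families such as a_1, a_2 are functions on nat of which only the indices
   occurring in the formulas (1, 2 or 1, 2, 3) are used. *)

definition K1 :: "(nat \<Rightarrow> complex) \<Rightarrow> (nat \<Rightarrow> complex) \<Rightarrow> (nat \<Rightarrow> complex) \<Rightarrow> complex" where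
  "K1 a b \<gamma> = \<gamma> 1 * a 1 * b 1 ^ 2 + \<gamma> 2 * a 1 ^ 2 * b 1 + \<gamma> 3 * a 1 ^ 3 + b 1 ^ 3"

definition K2 :: "(nat \<Rightarrow> complex) \<Rightarrow> (nat \<Rightarrow> complex) \<Rightarrow> (nat \<Rightarrow> complex) \<Rightarrow> complex" where
  "K2 a b \<gamma> = \<gamma> 1 * (a 2 * b 1 ^ 2 + 2 * a 1 * b 1 * b 2)
     + \<gamma> 2 * (a 1 ^ 2 * b 2 + 2 * a 1 * a 2 * b 1)
     + 3 * \<gamma> 3 * a 1 ^ 2 * a 2 + 3 * b 1 ^ 2 * b 2"

definition K3 :: "(nat \<Rightarrow> complex) \<Rightarrow> (nat \<Rightarrow> complex) \<Rightarrow> (nat \<Rightarrow> complex) \<Rightarrow> complex" where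
  "K3 a b \<gamma> = \<gamma> 1 * (a 1 * b 2 ^ 2 + 2 * a 2 * b 1 * b 2)
     + \<gamma> 2 * (a 2 ^ 2 * b 1 + 2 * a 1 * a 2 * b 2)
     + 3 * \<gamma> 3 * a 1 * a 2 ^ 2 + 3 * b 1 * b 2 ^ 2"

definition K4 :: "(nat \<Rightarrow> complex) \<Rightarrow> (nat \<Rightarrow> complex) \<Rightarrow> (nat \<Rightarrow> complex) \<Rightarrow> complex" where
  "K4 a b \<gamma> = \<gamma> 1 * a 2 * b 2 ^ 2 + \<gamma> 2 * a 2 ^ 2 * b 2 + \<gamma> 3 * a 2 ^ 3 + b 2 ^ 3"

definition coef :: "(nat \<Rightarrow> complex) \<Rightarrow> (nat \<Rightarrow> complex) \<Rightarrow> (nat \<Rightarrow> complex) \<Rightarrow> nat \<Rightarrow> nat \<Rightarrow> complex" where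
  "coef a b \<gamma> n l =
     (let c = a 1 * b 2 - a 2 * b 1 in
      if n = 1 \<and> l = 1 then (a 1 ^ 3 * b 2 - a 2 * K1 a b \<gamma>) / c
      else if n = 2 \<and> l = 1 then (- (a 1 ^ 3) * b 1 + a 1 * K1 a b \<gamma>) / c
      else if n = 1 \<and> l = 2 then (3 * a 1 ^ 2 * a 2 * b 2 - a 2 * K2 a b \<gamma>) / c
      else if n = 2 \<and> l = 2 then (- 3 * a 1 ^ 2 * a 2 * b 1 + a 1 * K2 a b \<gamma>) / c
      else if n = 1 \<and> l = 3 then (3 * a 1 * a 2 ^ 2 * b 2 - a 2 * K3 a b \<gamma>) / c
      else if n = 2 \<and> l = 3 then (- 3 * a 1 * a 2 ^ 2 * b 1 + a 1 * K3 a b \<gamma>) / c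
      else if n = 1 \<and> l = 4 then (a 2 ^ 3 * b 2 - a 2 * K4 a b \<gamma>) / c
      else if n = 2 \<and> l = 4 then (- (a 2 ^ 3) * b 1 + a 1 * K4 a b \<gamma>) / c
      else 0)"

definition cubic :: "(nat \<Rightarrow> nat \<Rightarrow> complex) \<Rightarrow> nat \<Rightarrow> complex \<Rightarrow> complex \<Rightarrow> complex" where
  "cubic c n z1 z2 = c n 1 * z1 ^ 3 + c n 2 * z1 ^ 2 * z2 + c n 3 * z1 * z2 ^ 2 + c n 4 * z2 ^ 3"

definition tau :: "real \<Rightarrow> real \<Rightarrow> complex" where
  "tau \<omega> t = (exp (2 * \<i> * of_real \<omega> * of_real t) - 1) / (2 * \<i> * of_real \<omega>)"

(* Weierstrass continuation of the germ of f at p 0 along a path p parametrised by the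
   whole real line: function elements (F t, D t), neighbouring ones having the same germ. *)
definition continuable_along :: "(complex \<Rightarrow> complex) \<Rightarrow> (real \<Rightarrow> complex) \<Rightarrow> bool" where
  "continuable_along f p \<longleftrightarrow>
     (\<exists>(F :: real \<Rightarrow> complex \<Rightarrow> complex) (D :: real \<Rightarrow> complex set).
        (\<forall>t. open (D t) \<and> connected (D t) \<and> p t \<in> D t \<and> F t holomorphic_on D t) \<and>
        (\<forall>\<^sub>F z in nhds (p 0). F 0 z = f z) \<and>
        (\<forall>t. \<exists>\<delta>>0. \<forall>s. \<bar>s - t\<bar> < \<delta> \<longrightarrow>
           p s \<in> D t \<and> (\<forall>\<^sub>F z in nhds (p s). F s z = F t z)))"

(* The germ at 0 of the solution x of the homogeneous system is unique, so it does not
   matter that it is introduced by an existential quantifier. *)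
definition generic_data ::
  "(nat \<Rightarrow> complex) \<Rightarrow> (nat \<Rightarrow> complex) \<Rightarrow> (nat \<Rightarrow> complex) \<Rightarrow> (nat \<Rightarrow> complex) \<Rightarrow> real
     \<Rightarrow> (nat \<Rightarrow> complex) \<Rightarrow> bool" where
  "generic_data a b \<gamma> u \<omega> \<xi> \<longleftrightarrow>
     (let y0 = a 1 * \<xi> 1 + a 2 * \<xi> 2; w0 = b 1 * \<xi> 1 + b 2 * \<xi> 2 in
      y0 \<noteq> 0 \<and> w0 / y0 \<notin> {u 1, u 2, u 3} \<and>
      (\<exists>(x :: nat \<Rightarrow> complex \<Rightarrow> complex) r. r > 0 \<and>
         (\<forall>n\<in>{1, 2}. x n 0 = \<xi> n \<and>
            (\<forall>\<tau>\<in>ball 0 r. (x n has_field_derivative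
                cubic (coef a b \<gamma>) n (x 1 \<tau>) (x 2 \<tau>)) (at \<tau>)) \<and>
            continuable_along (x n) (tau \<omega>))))"

definition is_solution ::
  "(nat \<Rightarrow> nat \<Rightarrow> complex) \<Rightarrow> real \<Rightarrow> (nat \<Rightarrow> complex) \<Rightarrow> (nat \<Rightarrow> real \<Rightarrow> complex) \<Rightarrow> bool" where
  "is_solution c \<omega> \<xi> x \<longleftrightarrow>
     (\<forall>n\<in>{1, 2}. x n 0 = \<xi> n \<and>
        (\<forall>t. (x n has_vector_derivative
                \<i> * of_real \<omega> * x n t + cubic c n (x 1 t) (x 2 t)) (at t)))"

end

theory Submission
  imports Defs
begin

text \<open>
  In the variables \<open>y = a\<^sub>1 x\<^sub>1 + a\<^sub>2 x\<^sub>2\<close> and \<open>w = b\<^sub>1 x\<^sub>1 + b\<^sub>2 x\<^sub>2\<close> the system becomes triangular: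
  \<open>y' = \<i>\<omega>y + y\<^sup>3\<close>, and \<open>w'\<close> is \<open>\<i>\<omega>w\<close> plus a binary cubic form in \<open>w\<close> and \<open>y\<close> (\<open>cubic_coef_y\<close>,
  \<open>cubic_coef_w\<close>). In terms of the roots \<open>u\<^sub>j\<close> this form is \<open>y\<^sup>2 w + \<Prod>\<^sub>l (w - u\<^sub>l y)\<close>, so that \<open>y\<close> and
  each \<open>v\<^sub>j = w - u\<^sub>j y\<close> solve scalar linear equations \<open>f' = g f\<close>:
  \<open>y\<close> with \<open>g = \<i>\<omega> + y\<^sup>2\<close>, and \<open>v\<^sub>j\<close> with \<open>g = \<i>\<omega> + y\<^sup>2 + \<Prod>\<^sub>l\<^sub>\<noteq>\<^sub>j v\<^sub>l\<close>.

  Two first integrals follow. One (\<open>y_first_integral\<close>) determines \<open>y\<^sup>2\<close> explicitly and shows that it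
  takes its initial value at every multiple of \<open>T = 2\<pi>/|\<omega>|\<close>. For the other
  (\<open>root_product_first_integral\<close>), the Lagrange identities \<open>\<Sum>\<^sub>j \<lambda>\<^sub>j = 0\<close> and
  \<open>\<Sum>\<^sub>j \<lambda>\<^sub>j \<Prod>\<^sub>l\<^sub>\<noteq>\<^sub>j v\<^sub>l = y\<^sup>2\<close> show that \<open>\<Prod>\<^sub>j v\<^sub>j\<close> to the powers \<open>\<lambda>\<^sub>j\<close> is a constant times \<open>y\<close> times \<open>exp (- \<i>\<omega>t)\<close>.
  As the \<open>\<lambda>\<^sub>j\<close> are rational, clearing denominators turns this relation into a polynomial equation. At the
  times \<open>kT\<close> the exponential is 1, and the two relations together leave only finitely many
  possible states \<open>(y, w)\<close>, with a bound \<open>D\<close> on their number that depends on the exponents alone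
  (\<open>card_states\<close>). By the pigeonhole principle two of the states at \<open>0, T, \<dots>, DT\<close> coincide, and
  uniqueness for the autonomous system (\<open>triangular_unique\<close>) makes the solution periodic with
  period \<open>dT\<close> for some \<open>1 \<le> d \<le> D\<close>. So \<open>N = D!\<close> serves all initial data.

  Existence for all real times (\<open>continuation_is_solution\<close>) comes from continuing the holomorphic
  solution of the homogeneous system along \<open>\<tau>(t)\<close>: the continued germs satisfy the same
  differential equation, and \<open>exp (\<i>\<omega>t) x(\<tau>(t))\<close> is the solution of the real-time system.
\<close>

section \<open>Scalar linear equations\<close>

text \<open>
  The function \<open>g\<close> is a logarithmic derivative of \<open>f\<close>. The equation \<open>f' = g f\<close> in place of
  \<open>g = f' / f\<close> makes sense also where \<open>f\<close> vanishes, so that differences of solutions are covered.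
\<close>

definition log_deriv :: "(real \<Rightarrow> complex) \<Rightarrow> (real \<Rightarrow> complex) \<Rightarrow> bool" where
  "log_deriv f g \<longleftrightarrow> (\<forall>t. (f has_vector_derivative g t * f t) (at t))"

lemma log_derivI:
  assumes "\<And>t. (f has_vector_derivative f' t) (at t)" and "\<And>t. f' t = g t * f t"
  shows "log_deriv f g"
  using assms unfolding log_deriv_def by metis

lemma log_deriv_mult:
  assumes "log_deriv f g" and "log_deriv h k"
  shows "log_deriv (\<lambda>t. f t * h t) (\<lambda>t. g t + k t)"
  unfolding log_deriv_def
proof
  fix t
  have "((\<lambda>t. f t * h t) has_vector_derivative f t * (k t * h t) + g t * f t * h t) (at t)"
    using assms by (intro has_vector_derivative_mult) (auto simp: log_deriv_def)
  then show "((\<lambda>t. f t * h t) has_vector_derivative (g t + k t) * (f t * h t)) (at t)"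
    by (simp add: algebra_simps)
qed

lemma log_deriv_power:
  assumes "log_deriv f g"
  shows "log_deriv (\<lambda>t. f t ^ n) (\<lambda>t. of_nat n * g t)"
proof (induction n)
  case 0
  show ?case by (simp add: log_deriv_def)
next
  case (Suc n)
  show ?case using log_deriv_mult[OF assms Suc] by (simp add: algebra_simps)
qed

lemma log_deriv_prod:
  assumes "finite J" and "\<And>j. j \<in> J \<Longrightarrow> log_deriv (f j) (g j)"
  shows "log_deriv (\<lambda>t. \<Prod>j\<in>J. f j t) (\<lambda>t. \<Sum>j\<in>J. g j t)"
  using assms
proof (induction J rule: finite_induct)
  case empty
  show ?case by (simp add: log_deriv_def)
next
  case (insert j J)
  then show ?case using log_deriv_mult[of "f j" "g j"] by simp
qed

lemma log_deriv_exp: "log_deriv (\<lambda>t. exp (k * of_real t)) (\<lambda>t. k)"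
proof (rule log_derivI)
  fix t
  show "((\<lambda>t. exp (k * of_real t)) has_vector_derivative k * exp (k * of_real t)) (at t)"
    by (auto intro!: derivative_eq_intros has_vector_derivative_real_field)
qed simp

lemma log_deriv_lincomb:
  assumes "log_deriv f g" and "log_deriv h g"
  shows "log_deriv (\<lambda>t. B * f t - C * h t) g"
proof (rule log_derivI)
  fix t
  show "((\<lambda>t. B * f t - C * h t) has_vector_derivative B * (g t * f t) - C * (g t * h t)) (at t)"
    using assms unfolding log_deriv_def by (auto intro!: derivative_eq_intros)
qed (simp add: algebra_simps)

text \<open>
  If \<open>G\<close> is a primitive of \<open>g\<close> then \<open>f exp (- G)\<close> has derivative zero. The uniqueness statement and
  the first integrals below all reduce to this, with \<open>f\<close> the difference of the two sides of the
  asserted equation.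
\<close>

lemma log_deriv_eq_0:
  assumes f: "log_deriv f g" and g: "continuous_on UNIV g" and "f s = 0"
  shows "f t = 0"
proof -
  define I where "I = {min s t..max s t}"
  define G where "G = (\<lambda>x. integral {min s t..x} g)"
  have G: "(G has_vector_derivative g x) (at x within I)" if "x \<in> I" for x
    unfolding I_def G_def
    by (rule integral_has_vector_derivative) (use that g in \<open>auto simp: I_def intro: continuous_on_subset\<close>)
  have "((\<lambda>x. f x * exp (- G x)) has_vector_derivative 0) (at x within I)" if "x \<in> I" for x
  proof -
    have "((\<lambda>x. exp (- G x)) has_vector_derivative - g x * exp (- G x)) (at x within I)"
      using field_vector_diff_chain_within[OF has_vector_derivative_minus[OF G[OF that]], of exp "exp (- G x)"]
      by (auto simp: o_def intro: DERIV_exp DERIV_subset)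
    moreover have "(f has_vector_derivative g x * f x) (at x within I)"
      using f by (auto simp: log_deriv_def intro: has_vector_derivative_at_within)
    ultimately show ?thesis
      using has_vector_derivative_mult by (fastforce simp: algebra_simps)
  qed
  then obtain k where "\<And>x. x \<in> I \<Longrightarrow> f x * exp (- G x) = k"
    using has_vector_derivative_zero_constant[of I] by (auto simp: I_def)
  from this[of s] this[of t] \<open>f s = 0\<close> show ?thesis by (auto simp: I_def)
qed

section \<open>The system in the variables y and w\<close>

lemma coef_simps:
  "coef a b \<gamma> 1 1 = (a 1 ^ 3 * b 2 - a 2 * K1 a b \<gamma>) / (a 1 * b 2 - a 2 * b 1)"
  "coef a b \<gamma> 2 1 = (- (a 1 ^ 3) * b 1 + a 1 * K1 a b \<gamma>) / (a 1 * b 2 - a 2 * b 1)"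
  "coef a b \<gamma> 1 2 = (3 * a 1 ^ 2 * a 2 * b 2 - a 2 * K2 a b \<gamma>) / (a 1 * b 2 - a 2 * b 1)"
  "coef a b \<gamma> 2 2 = (- 3 * a 1 ^ 2 * a 2 * b 1 + a 1 * K2 a b \<gamma>) / (a 1 * b 2 - a 2 * b 1)"
  "coef a b \<gamma> 1 3 = (3 * a 1 * a 2 ^ 2 * b 2 - a 2 * K3 a b \<gamma>) / (a 1 * b 2 - a 2 * b 1)"
  "coef a b \<gamma> 2 3 = (- 3 * a 1 * a 2 ^ 2 * b 1 + a 1 * K3 a b \<gamma>) / (a 1 * b 2 - a 2 * b 1)"
  "coef a b \<gamma> 1 4 = (a 2 ^ 3 * b 2 - a 2 * K4 a b \<gamma>) / (a 1 * b 2 - a 2 * b 1)"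
  "coef a b \<gamma> 2 4 = (- (a 2 ^ 3) * b 1 + a 1 * K4 a b \<gamma>) / (a 1 * b 2 - a 2 * b 1)"
  by (simp_all add: coef_def)

text \<open>
  The coefficients have the form of Cramer's rule for the linear change of variables with matrix
  rows \<open>a\<close> and \<open>b\<close>; here \<open>p\<close> and \<open>q\<close> are the prescribed coefficients of one monomial in the equations
  for \<open>y\<close> and \<open>w\<close>.
\<close>

lemma cramer:
  fixes a1 a2 b1 b2 :: complex
  assumes "a1 * b2 - a2 * b1 \<noteq> 0"
  shows "a1 * ((p * b2 - a2 * q) / (a1 * b2 - a2 * b1)) + a2 * ((- p * b1 + a1 * q) / (a1 * b2 - a2 * b1)) = p"
   and "b1 * ((p * b2 - a2 * q) / (a1 * b2 - a2 * b1)) + b2 * ((- p * b1 + a1 * q) / (a1 * b2 - a2 * b1)) = q"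
proof -
  have "a1 * (p * b2 - a2 * q) + a2 * (- p * b1 + a1 * q) = (a1 * b2 - a2 * b1) * p"
   "b1 * (p * b2 - a2 * q) + b2 * (- p * b1 + a1 * q) = (a1 * b2 - a2 * b1) * q"
    by (simp_all add: algebra_simps)
  with assms show "a1 * ((p * b2 - a2 * q) / (a1 * b2 - a2 * b1)) + a2 * ((- p * b1 + a1 * q) / (a1 * b2 - a2 * b1)) = p"
   and "b1 * ((p * b2 - a2 * q) / (a1 * b2 - a2 * b1)) + b2 * ((- p * b1 + a1 * q) / (a1 * b2 - a2 * b1)) = q"
    by (simp_all flip: add_divide_distrib)
qed

lemma coef_combine:
  assumes "a 1 * b 2 - a 2 * b 1 \<noteq> 0"
  shows
    "a 1 * coef a b \<gamma> 1 1 + a 2 * coef a b \<gamma> 2 1 = a 1 ^ 3"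
    "a 1 * coef a b \<gamma> 1 2 + a 2 * coef a b \<gamma> 2 2 = 3 * a 1 ^ 2 * a 2"
    "a 1 * coef a b \<gamma> 1 3 + a 2 * coef a b \<gamma> 2 3 = 3 * a 1 * a 2 ^ 2"
    "a 1 * coef a b \<gamma> 1 4 + a 2 * coef a b \<gamma> 2 4 = a 2 ^ 3"
    "b 1 * coef a b \<gamma> 1 1 + b 2 * coef a b \<gamma> 2 1 = K1 a b \<gamma>"
    "b 1 * coef a b \<gamma> 1 2 + b 2 * coef a b \<gamma> 2 2 = K2 a b \<gamma>"
    "b 1 * coef a b \<gamma> 1 3 + b 2 * coef a b \<gamma> 2 3 = K3 a b \<gamma>"
    "b 1 * coef a b \<gamma> 1 4 + b 2 * coef a b \<gamma> 2 4 = K4 a b \<gamma>"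
  using cramer[OF assms, of "a 1 ^ 3" "K1 a b \<gamma>"] cramer[OF assms, of "3 * a 1 ^ 2 * a 2" "K2 a b \<gamma>"]
    cramer[OF assms, of "3 * a 1 * a 2 ^ 2" "K3 a b \<gamma>"] cramer[OF assms, of "a 2 ^ 3" "K4 a b \<gamma>"]
  unfolding coef_simps by simp_all

lemma cubic_combine:
  "p * cubic c 1 x1 x2 + q * cubic c 2 x1 x2 =
    (p * c 1 1 + q * c 2 1) * x1 ^ 3 + (p * c 1 2 + q * c 2 2) * x1 ^ 2 * x2
    + (p * c 1 3 + q * c 2 3) * x1 * x2 ^ 2 + (p * c 1 4 + q * c 2 4) * x2 ^ 3"
  by (simp add: cubic_def algebra_simps)

lemma cubic_coef_y:
  assumes "a 1 * b 2 - a 2 * b 1 \<noteq> 0"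
  shows "a 1 * cubic (coef a b \<gamma>) 1 x1 x2 + a 2 * cubic (coef a b \<gamma>) 2 x1 x2
    = (a 1 * x1 + a 2 * x2) ^ 3"
  unfolding cubic_combine coef_combine[OF assms] by (simp add: algebra_simps power2_eq_square power3_eq_cube)

lemma cubic_coef_w:
  assumes "a 1 * b 2 - a 2 * b 1 \<noteq> 0" and "y = a 1 * x1 + a 2 * x2" and "w = b 1 * x1 + b 2 * x2"
  shows "b 1 * cubic (coef a b \<gamma>) 1 x1 x2 + b 2 * cubic (coef a b \<gamma>) 2 x1 x2
    = w ^ 3 + \<gamma> 1 * y * w ^ 2 + \<gamma> 2 * y ^ 2 * w + \<gamma> 3 * y ^ 3"
  unfolding cubic_combine coef_combine[OF assms(1)] K1_def K2_def K3_def K4_def assms(2,3)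
  by (simp add: algebra_simps power2_eq_square power3_eq_cube)

section \<open>Existence by continuation along the circle\<close>

lemma tau_has_vector_derivative:
  assumes "\<omega> \<noteq> 0"
  shows "(tau \<omega> has_vector_derivative exp (2 * \<i> * of_real \<omega> * of_real t)) (at t)"
proof -
  have "((\<lambda>t. (exp (2 * \<i> * of_real \<omega> * of_real t) - 1) / (2 * \<i> * of_real \<omega>))
     has_vector_derivative exp (2 * \<i> * of_real \<omega> * of_real t)) (at t)"
    using assms
    by (auto intro!: derivative_eq_intros has_vector_derivative_real_field)
  then show ?thesis by (simp add: tau_def[abs_def])
qed

text \<open>
  The permanence of functional equations: the set of times at which the continued germs satisfy the
  homogeneous system is open and closed, since on a small ball around \<open>\<tau>(t)\<close> the defect of the
  equation is holomorphic and the germs at nearby times are given by the same pair of functions.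
\<close>

lemma continuation_is_solution:
  assumes "\<omega> \<noteq> 0" and "r > 0"
    and init: "\<forall>n\<in>{1, 2}. x n 0 = \<xi> n \<and>
            (\<forall>\<tau>\<in>ball 0 r. (x n has_field_derivative cubic c n (x 1 \<tau>) (x 2 \<tau>)) (at \<tau>)) \<and>
            continuable_along (x n) (tau \<omega>)"
  shows "\<exists>x. is_solution c \<omega> \<xi> x"
proof -
  define p where "p = tau \<omega>"
  have p_cont: "isCont p t" for t
    unfolding p_def using tau_has_vector_derivative[OF \<open>\<omega> \<noteq> 0\<close>] has_vector_derivative_continuous by blast
  have p0: "p 0 = 0" by (simp add: p_def tau_def)
  define elements where "elements f F D \<longleftrightarrow>
        (\<forall>t. open (D t) \<and> connected (D t) \<and> p t \<in> D t \<and> F t holomorphic_on D t) \<and>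
        (\<forall>\<^sub>F z in nhds (p 0). F 0 z = f z) \<and>
        (\<forall>t. \<exists>\<delta>>0. \<forall>s. \<bar>s - t\<bar> < \<delta> \<longrightarrow>
           p s \<in> D t \<and> (\<forall>\<^sub>F z in nhds (p s). F s z = F t z))"
    for f and F :: "real \<Rightarrow> complex \<Rightarrow> complex" and D :: "real \<Rightarrow> complex set"
  have "\<forall>n\<in>{1, 2}. \<exists>F D. elements (x n) F D"
    using init unfolding continuable_along_def p_def[symmetric] elements_def by simp
  then obtain F D where elements: "\<And>n. n \<in> {1, 2} \<Longrightarrow> elements (x n) (F n) (D n)"
    by metis
  have FD: "\<forall>t. open (D n t) \<and> connected (D n t) \<and> p t \<in> D n t \<and> F n t holomorphic_on D n t"
      "\<forall>\<^sub>F z in nhds (p 0). F n 0 z = x n z"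
    if "n \<in> {1, 2}" for n
    using elements[OF that] by (auto simp: elements_def)
  have germ: "\<forall>\<^sub>F s in nhds t. \<forall>\<^sub>F z in nhds (p s). F n s z = F n t z" if n: "n \<in> {1, 2}" for n t
  proof -
    obtain \<delta> where "\<delta> > 0" "\<forall>s. \<bar>s - t\<bar> < \<delta> \<longrightarrow> (\<forall>\<^sub>F z in nhds (p s). F n s z = F n t z)"
      using elements[OF n] unfolding elements_def by metis
    then show ?thesis by (auto simp: eventually_nhds_metric dist_real_def)
  qed
  define E where "E n t z = deriv (F n t) z - cubic c n (F 1 t z) (F 2 t z)" for n t z
  define P where "P t \<longleftrightarrow> (\<forall>n\<in>{1, 2}. \<forall>\<^sub>F z in nhds (p t). E n t z = 0)" for t
  have P_local: "\<forall>\<^sub>F s in at t. P t = P s" for t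
  proof -
    \<comment> \<open>A ball, because the intersection of the two connected domains may be disconnected.\<close>
    have "open (D 1 t \<inter> D 2 t)" "p t \<in> D 1 t \<inter> D 2 t" using FD(1)[of 1] FD(1)[of 2] by auto
    then obtain e where "e > 0" and e: "ball (p t) e \<subseteq> D 1 t \<inter> D 2 t"
      using open_contains_ball by metis
    define B where "B = ball (p t) e"
    have B: "open B" "connected B" "p t \<in> B" using \<open>e > 0\<close> by (auto simp: B_def)
    have hol: "F n t holomorphic_on B" if "n \<in> {1, 2}" for n
      using FD(1)[OF that] e that by (auto simp: B_def intro: holomorphic_on_subset)
    have E_hol: "E n t holomorphic_on B" if "n \<in> {1, 2}" for n
      unfolding E_def cubic_def
      by (intro holomorphic_intros holomorphic_deriv hol that B) auto
    have E_iff: "(\<forall>\<^sub>F z in nhds q. E n t z = 0) \<longleftrightarrow> (\<forall>z\<in>B. E n t z = 0)"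
      if n: "n \<in> {1, 2}" and q: "q \<in> B" for n q
    proof
      assume "\<forall>z\<in>B. E n t z = 0"
      then show "\<forall>\<^sub>F z in nhds q. E n t z = 0" using B q by (auto simp: eventually_nhds)
    next
      assume "\<forall>\<^sub>F z in nhds q. E n t z = 0"
      then obtain U where U: "open U" "q \<in> U" "\<forall>z\<in>U. E n t z = 0"
        by (auto simp: eventually_nhds)
      have "E n t z = (\<lambda>_. 0) z" if "z \<in> B" for z
        by (rule analytic_continuation_open[of "U \<inter> B" B])
          (use U B q that E_hol[OF n] in auto)
      then show "\<forall>z\<in>B. E n t z = 0" by simp
    qed
    have "\<forall>\<^sub>F s in nhds t. p s \<in> B"
      using p_cont[of t, unfolded isCont_def, THEN topological_tendstoD, OF B(1,3)] B(3)
      by (auto simp: eventually_at_filter elim: eventually_mono)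
    moreover have "\<forall>\<^sub>F s in nhds t. \<forall>\<^sub>F z in nhds (p s). F 1 s z = F 1 t z"
      using germ by simp
    moreover have "\<forall>\<^sub>F s in nhds t. \<forall>\<^sub>F z in nhds (p s). F 2 s z = F 2 t z"
      using germ by simp
    ultimately have "\<forall>\<^sub>F s in nhds t. P s \<longleftrightarrow> P t"
    proof eventually_elim
      case (elim s)
      have E_eq: "\<forall>\<^sub>F z in nhds (p s). E n s z = E n t z" if n: "n \<in> {1, 2}" for n
      proof -
        have "\<forall>\<^sub>F z in nhds (p s). F n s z = F n t z" using elim n by auto
        then have "\<forall>\<^sub>F z in nhds (p s). \<forall>\<^sub>F z' in nhds z. F n s z' = F n t z'"
          by (simp add: eventually_eventually)
        then show ?thesis using elim(2,3)
        proof eventually_elim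
          case (elim z)
          then have "deriv (F n s) z = deriv (F n t) z" by (intro deriv_cong_ev) auto
          with elim show ?case by (simp add: E_def)
        qed
      qed
      have "(\<forall>\<^sub>F z in nhds (p s). E n s z = 0) \<longleftrightarrow> (\<forall>\<^sub>F z in nhds (p t). E n t z = 0)"
        if n: "n \<in> {1, 2}" for n
      proof -
        have "(\<forall>\<^sub>F z in nhds (p s). E n s z = 0) \<longleftrightarrow> (\<forall>\<^sub>F z in nhds (p s). E n t z = 0)"
          by (rule eventually_cong[OF E_eq[OF n]]) simp
        then show ?thesis using E_iff[OF n] elim B by simp
      qed
      then show ?case by (simp add: P_def)
    qed
    then show ?thesis by (auto simp: eventually_at_filter elim: eventually_mono)
  qed
  have "P 0" unfolding P_def
  proof
    fix n :: nat assume n: "n \<in> {1, 2}"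
    have ev: "\<forall>\<^sub>F z in nhds (p 0). F n 0 z = x n z" if "n \<in> {1, 2}" for n
      using FD(2)[OF that] by simp
    have 1: "\<forall>\<^sub>F z in nhds (p 0). \<forall>\<^sub>F z' in nhds z. F n 0 z' = x n z'"
      using ev[OF n] by (simp add: eventually_eventually)
    have 2: "\<forall>\<^sub>F z in nhds (p 0). F 1 0 z = x 1 z" "\<forall>\<^sub>F z in nhds (p 0). F 2 0 z = x 2 z"
      using ev by simp_all
    have 3: "\<forall>\<^sub>F z in nhds (p 0). z \<in> ball 0 r"
      using \<open>r > 0\<close> p0 by (intro eventually_nhds_in_open) auto
    from 1 2 3 show "\<forall>\<^sub>F z in nhds (p 0). E n 0 z = 0"
    proof eventually_elim
      case (elim z)
      have "(x n has_field_derivative cubic c n (x 1 z) (x 2 z)) (at z)"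
        using init n elim by blast
      then have "deriv (x n) z = cubic c n (x 1 z) (x 2 z)" by (rule DERIV_imp_deriv)
      moreover have "deriv (F n 0) z = deriv (x n) z" using elim by (intro deriv_cong_ev) auto
      ultimately show ?case using elim by (simp add: E_def)
    qed
  qed
  have P: "P t" for t
  proof -
    have "P 0 = P t"
      by (rule connected_local_const[of UNIV]) (use P_local in auto)
    with \<open>P 0\<close> show ?thesis by simp
  qed
  have F_deriv: "(F n t has_field_derivative cubic c n (F 1 t (p t)) (F 2 t (p t))) (at (p t))"
    if n: "n \<in> {1, 2}" for n t
  proof -
    have "E n t (p t) = 0" using P[of t] n eventually_nhds_x_imp_x unfolding P_def by blast
    moreover have "(F n t has_field_derivative deriv (F n t) (p t)) (at (p t))"
      using FD(1)[OF n] by (auto intro: holomorphic_derivI)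
    ultimately show ?thesis by (simp add: E_def)
  qed
  define X where "X n t = exp (\<i> * of_real \<omega> * of_real t) * F n t (p t)" for n t
  have "is_solution c \<omega> \<xi> X"
    unfolding is_solution_def
  proof (intro ballI conjI allI)
    fix n :: nat assume n: "n \<in> {1, 2}"
    show "X n 0 = \<xi> n"
      using FD(2)[OF n] init n p0 eventually_nhds_x_imp_x[of "\<lambda>z. F n 0 z = x n z" 0]
      by (auto simp: X_def)
    fix t
    let ?e = "exp (\<i> * of_real \<omega> * of_real t)"
    let ?C = "cubic c n (F 1 t (p t)) (F 2 t (p t))"
    have "((\<lambda>s. F n t (p s)) has_vector_derivative exp (2 * \<i> * of_real \<omega> * of_real t) * ?C) (at t)"
      using field_vector_diff_chain_at[OF tau_has_vector_derivative[OF \<open>\<omega> \<noteq> 0\<close>, of t] F_deriv[OF n, of t, unfolded p_def]]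
      by (simp add: o_def p_def)
    moreover have "((\<lambda>s. exp (\<i> * of_real \<omega> * of_real s)) has_vector_derivative \<i> * of_real \<omega> * ?e) (at t)"
      using log_deriv_exp[of "\<i> * of_real \<omega>"] by (simp add: log_deriv_def)
    ultimately have "((\<lambda>s. exp (\<i> * of_real \<omega> * of_real s) * F n t (p s)) has_vector_derivative
        ?e * (exp (2 * \<i> * of_real \<omega> * of_real t) * ?C) + \<i> * of_real \<omega> * ?e * F n t (p t)) (at t)"
      using has_vector_derivative_mult by blast
    also have "exp (2 * \<i> * of_real \<omega> * of_real t) = ?e ^ 2"
      by (simp add: mult.assoc flip: exp_double)
    also have "?e * (?e ^ 2 * ?C) + \<i> * of_real \<omega> * ?e * F n t (p t)
        = \<i> * of_real \<omega> * X n t + cubic c n (X 1 t) (X 2 t)"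
      by (simp add: X_def cubic_def power2_eq_square power3_eq_cube algebra_simps)
    finally have D: "((\<lambda>s. exp (\<i> * of_real \<omega> * of_real s) * F n t (p s)) has_vector_derivative
        \<i> * of_real \<omega> * X n t + cubic c n (X 1 t) (X 2 t)) (at t)" .
    have ev: "\<forall>\<^sub>F s in nhds t. exp (\<i> * of_real \<omega> * of_real s) * F n t (p s) = X n s"
      using germ[OF n, of t]
    proof eventually_elim
      case (elim s)
      from eventually_nhds_x_imp_x[OF this] show ?case by (simp add: X_def)
    qed
    show "(X n has_vector_derivative
        \<i> * of_real \<omega> * X n t + cubic c n (X 1 t) (X 2 t)) (at t)"
      by (rule iffD1[OF has_vector_derivative_cong_ev, rotated 2, OF D])
        (use ev eventually_nhds_x_imp_x[OF ev] in auto)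
  qed
  then show ?thesis by blast
qed

section \<open>Uniqueness\<close>

lemma has_vector_derivative_shift:
  fixes f :: "real \<Rightarrow> complex"
  assumes "(f has_vector_derivative d) (at (t + h))"
  shows "((\<lambda>t. f (t + h)) has_vector_derivative d) (at t)"
proof -
  have "((\<lambda>t. t + h) has_vector_derivative 1) (at t)"
    by (auto intro!: derivative_eq_intros)
  from vector_diff_chain_at[OF this, of f d] assms show ?thesis by (simp add: o_def)
qed

text \<open>
  The triangular form reduces uniqueness to scalar equations. The difference \<open>\<delta>\<close> of the two
  \<open>y\<close>-components satisfies \<open>\<delta>' = g \<delta>\<close>, because \<open>y\<^sub>1\<^sup>3 - y\<^sub>2\<^sup>3\<close> is divisible by \<open>y\<^sub>1 - y\<^sub>2\<close>; once the
  \<open>y\<close>-components agree, the same argument applies to \<open>w\<close>.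
\<close>

lemma triangular_unique:
  fixes y1 y2 w1 w2 :: "real \<Rightarrow> complex"
  assumes y1: "\<And>t. (y1 has_vector_derivative \<kappa> * y1 t + y1 t ^ 3) (at t)"
    and y2: "\<And>t. (y2 has_vector_derivative \<kappa> * y2 t + y2 t ^ 3) (at t)"
    and w1: "\<And>t. (w1 has_vector_derivative \<kappa> * w1 t
        + (w1 t ^ 3 + g1 * y1 t * w1 t ^ 2 + g2 * y1 t ^ 2 * w1 t + g3 * y1 t ^ 3)) (at t)"
    and w2: "\<And>t. (w2 has_vector_derivative \<kappa> * w2 t
        + (w2 t ^ 3 + g1 * y2 t * w2 t ^ 2 + g2 * y2 t ^ 2 * w2 t + g3 * y2 t ^ 3)) (at t)"
    and eq: "y1 s = y2 s" "w1 s = w2 s"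
  shows "y1 t = y2 t" and "w1 t = w2 t"
proof -
  note cont [continuous_intros] =
    y1[THEN has_vector_derivative_continuous] y2[THEN has_vector_derivative_continuous]
    w1[THEN has_vector_derivative_continuous] w2[THEN has_vector_derivative_continuous]
  have "log_deriv (\<lambda>t. y1 t - y2 t) (\<lambda>t. \<kappa> + (y1 t ^ 2 + y1 t * y2 t + y2 t ^ 2))"
    by (rule log_derivI[OF has_vector_derivative_diff[OF y1 y2]])
      (simp add: algebra_simps power2_eq_square power3_eq_cube)
  then have "y1 t - y2 t = 0" for t
    by (rule log_deriv_eq_0)
      (use eq in \<open>auto intro!: continuous_at_imp_continuous_on continuous_intros\<close>)
  then have y: "y2 t = y1 t" for t by (metis eq_iff_diff_eq_0)
  then show "y1 t = y2 t" by simp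
  have "log_deriv (\<lambda>t. w1 t - w2 t) (\<lambda>t. \<kappa> + (w1 t ^ 2 + w1 t * w2 t + w2 t ^ 2
      + g1 * y1 t * (w1 t + w2 t) + g2 * y1 t ^ 2))"
    by (rule log_derivI[OF has_vector_derivative_diff[OF w1 w2]])
      (simp add: y algebra_simps power2_eq_square power3_eq_cube)
  then have "w1 t - w2 t = 0"
    by (rule log_deriv_eq_0)
      (use eq in \<open>auto intro!: continuous_at_imp_continuous_on continuous_intros\<close>)
  then show "w1 t = w2 t" by simp
qed

section \<open>First integrals\<close>

text \<open>
  In the time \<open>\<tau>\<close> the function \<open>\<eta> = exp (- \<i>\<omega>t) y\<close> satisfies \<open>d\<eta>/d\<tau> = \<eta>\<^sup>3\<close>, hence \<open>\<eta>\<^sup>-\<^sup>2 + 2\<tau>\<close> is constant. The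
  form without division does not presuppose that \<open>y\<close> never vanishes.
\<close>

lemma y_first_integral:
  assumes "\<omega> \<noteq> 0"
    and y: "\<And>t. (y has_vector_derivative \<i> * of_real \<omega> * y t + y t ^ 3) (at t)"
    and "y 0 \<noteq> 0"
  shows "y t ^ 2 * (1 / y 0 ^ 2 - 2 * tau \<omega> t) = exp (2 * \<i> * of_real \<omega> * of_real t)"
proof -
  note cont [continuous_intros] = y[THEN has_vector_derivative_continuous]
  let ?e = "\<lambda>t. exp (2 * \<i> * of_real \<omega> * of_real t)"
  have ld: "log_deriv y (\<lambda>t. \<i> * of_real \<omega> + y t ^ 2)"
    by (rule log_derivI[OF y]) (simp add: algebra_simps power2_eq_square power3_eq_cube)
  have 1: "((\<lambda>t. y t ^ 2) has_vector_derivative of_nat 2 * (\<i> * of_real \<omega> + y t ^ 2) * y t ^ 2) (at t)" for t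
    using log_deriv_power[OF ld, of 2] unfolding log_deriv_def by blast
  have 2: "((\<lambda>t. 1 / y 0 ^ 2 - 2 * tau \<omega> t) has_vector_derivative - 2 * ?e t) (at t)" for t
    using tau_has_vector_derivative[OF \<open>\<omega> \<noteq> 0\<close>] by (auto intro!: derivative_eq_intros)
  have 3: "(?e has_vector_derivative 2 * \<i> * of_real \<omega> * ?e t) (at t)" for t
    using log_deriv_exp unfolding log_deriv_def by blast
  have "log_deriv (\<lambda>t. y t ^ 2 * (1 / y 0 ^ 2 - 2 * tau \<omega> t) - ?e t) (\<lambda>t. 2 * (\<i> * of_real \<omega> + y t ^ 2))"
    by (rule log_derivI[OF has_vector_derivative_diff[OF has_vector_derivative_mult[OF 1 2] 3]])
      (simp add: algebra_simps)
  then have "y t ^ 2 * (1 / y 0 ^ 2 - 2 * tau \<omega> t) - ?e t = 0"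
    by (rule log_deriv_eq_0[where s = 0])
      (use \<open>y 0 \<noteq> 0\<close> in \<open>auto simp: tau_def intro!: continuous_at_imp_continuous_on continuous_intros\<close>)
  then show ?thesis by simp
qed

text \<open>
  This is the integral of \<open>du / P(u) = y\<^sup>2 d\<tau>\<close> for \<open>u = w / y\<close> and \<open>P(u) = \<Prod>\<^sub>j (u - u\<^sub>j)\<close>, obtained from the
  partial fractions of \<open>1 / P\<close> with residues \<open>(p\<^sub>j - q\<^sub>j) / M\<close>. Distributing positive and negative
  exponents over \<open>R\<close> and \<open>S\<close> avoids division: the two have the same logarithmic derivative.
\<close>

lemma root_product_first_integral:
  fixes y w :: "real \<Rightarrow> complex" and p q :: "'j \<Rightarrow> nat"
  assumes J: "finite J"
    and y: "\<And>t. (y has_vector_derivative \<kappa> * y t + y t ^ 3) (at t)"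
    and w: "\<And>t. (w has_vector_derivative
        \<kappa> * w t + (y t ^ 2 * w t + (\<Prod>l\<in>J. w t - u l * y t))) (at t)"
    and sum0: "(\<Sum>j\<in>J. of_nat (p j) - of_nat (q j)) = (0::complex)"
    and lagrange: "\<And>Y W. (\<Sum>j\<in>J. (of_nat (p j) - of_nat (q j)) * (\<Prod>l\<in>J - {j}. W - u l * Y))
        = of_nat M * Y ^ 2"
  defines "R \<equiv> \<lambda>t. (\<Prod>j\<in>J. (w t - u j * y t) ^ p j) * exp (of_nat M * \<kappa> * of_real t)"
    and "S \<equiv> \<lambda>t. (\<Prod>j\<in>J. (w t - u j * y t) ^ q j) * y t ^ M"
  shows "S 0 * R t = R 0 * S t"
proof -
  note cont [continuous_intros] =
    y[THEN has_vector_derivative_continuous] w[THEN has_vector_derivative_continuous]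
  define k where "k j t = \<kappa> + y t ^ 2 + (\<Prod>l\<in>J - {j}. w t - u l * y t)" for j t
  have ld_y: "log_deriv y (\<lambda>t. \<kappa> + y t ^ 2)"
    by (rule log_derivI[OF y]) (simp add: algebra_simps power2_eq_square power3_eq_cube)
  have ld_v: "log_deriv (\<lambda>t. w t - u j * y t) (k j)" if "j \<in> J" for j
  proof (rule log_derivI)
    fix t
    show "((\<lambda>t. w t - u j * y t) has_vector_derivative
        \<kappa> * w t + (y t ^ 2 * w t + (\<Prod>l\<in>J. w t - u l * y t)) - u j * (\<kappa> * y t + y t ^ 3)) (at t)"
      using y w by (auto intro!: derivative_eq_intros)
    show "\<kappa> * w t + (y t ^ 2 * w t + (\<Prod>l\<in>J. w t - u l * y t)) - u j * (\<kappa> * y t + y t ^ 3)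
        = k j t * (w t - u j * y t)"
      unfolding k_def prod.remove[OF J that]
      by (simp add: algebra_simps power2_eq_square power3_eq_cube)
  qed
  have R: "log_deriv R (\<lambda>t. (\<Sum>j\<in>J. of_nat (p j) * k j t) + of_nat M * \<kappa>)"
    unfolding R_def by (intro log_deriv_mult log_deriv_prod log_deriv_power log_deriv_exp J ld_v)
  have S: "log_deriv S (\<lambda>t. (\<Sum>j\<in>J. of_nat (q j) * k j t) + of_nat M * (\<kappa> + y t ^ 2))"
    unfolding S_def by (intro log_deriv_mult log_deriv_prod log_deriv_power ld_y J ld_v)
  have "(\<Sum>j\<in>J. of_nat (p j) * k j t) - (\<Sum>j\<in>J. of_nat (q j) * k j t) = of_nat M * y t ^ 2" for t
  proof -
    have "(\<Sum>j\<in>J. of_nat (p j) * k j t) - (\<Sum>j\<in>J. of_nat (q j) * k j t)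
        = (\<Sum>j\<in>J. of_nat (p j) - of_nat (q j)) * (\<kappa> + y t ^ 2)
          + (\<Sum>j\<in>J. (of_nat (p j) - of_nat (q j)) * (\<Prod>l\<in>J - {j}. w t - u l * y t))"
      by (simp add: k_def algebra_simps sum.distrib sum_subtractf sum_distrib_left sum_distrib_right)
    then show ?thesis by (simp only: sum0 lagrange) simp
  qed
  then have "(\<Sum>j\<in>J. of_nat (p j) * k j t) + of_nat M * \<kappa>
      = (\<Sum>j\<in>J. of_nat (q j) * k j t) + of_nat M * (\<kappa> + y t ^ 2)" for t
    by (simp add: algebra_simps)
  with R have "log_deriv R (\<lambda>t. (\<Sum>j\<in>J. of_nat (q j) * k j t) + of_nat M * (\<kappa> + y t ^ 2))"
    by simp
  from log_deriv_lincomb[OF this S, of "S 0" "R 0"]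
  have "S 0 * R t - R 0 * S t = 0"
    by (rule log_deriv_eq_0[where s = 0])
      (auto simp: k_def intro!: continuous_at_imp_continuous_on continuous_intros)
  then show ?thesis by simp
qed

section \<open>Finitely many states\<close>

text \<open>
  The equation is polynomial in \<open>w\<close> and its two sides may have equal degrees and leading coefficients.
  It is nevertheless not an identity: at \<open>w = u\<^sub>i y\<close> exactly one side vanishes.
\<close>

lemma card_level_set:
  fixes u :: "'j \<Rightarrow> complex" and p q :: "'j \<Rightarrow> nat"
  assumes J: "finite J" "J \<noteq> {}" and inj: "inj_on u J" and "y \<noteq> 0" and "C \<noteq> 0"
    and pq: "\<And>j. j \<in> J \<Longrightarrow> (p j = 0) \<noteq> (q j = 0)"
  defines "Z \<equiv> {w. (\<Prod>j\<in>J. (w - u j * y) ^ p j) = C * (\<Prod>j\<in>J. (w - u j * y) ^ q j)}"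
  shows "finite Z" and "card Z \<le> (\<Sum>j\<in>J. p j + q j)"
proof -
  define A where "A r = (\<Prod>j\<in>J. [:- u j * y, 1:] ^ r j)" for r :: "'j \<Rightarrow> nat"
  define Q where "Q = A p - smult C (A q)"
  have poly_A: "poly (A r) w = (\<Prod>j\<in>J. (w - u j * y) ^ r j)" for r w
    by (simp add: A_def poly_prod poly_power)
  have poly_A_0: "poly (A r) (u i * y) = 0 \<longleftrightarrow> r i \<noteq> 0" if "i \<in> J" for r i
    using J that \<open>y \<noteq> 0\<close> inj by (auto simp: poly_A dest: inj_onD)
  have deg_A: "degree (A r) \<le> (\<Sum>j\<in>J. r j)" for r
    unfolding A_def
    by (rule order.trans[OF degree_prod_sum_le[OF J(1)]]) (auto intro!: sum_mono simp: degree_linear_power)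
  obtain i where i: "i \<in> J" using J by blast
  have "poly Q (u i * y) \<noteq> 0"
    using pq[OF i] poly_A_0[OF i, of p] poly_A_0[OF i, of q] \<open>C \<noteq> 0\<close> by (auto simp: Q_def)
  then have "Q \<noteq> 0" by auto
  have Z: "Z = {w. poly Q w = 0}" by (simp add: Z_def Q_def poly_A)
  show "finite Z" unfolding Z using \<open>Q \<noteq> 0\<close> by (rule poly_roots_finite)
  have "card Z \<le> degree Q" unfolding Z using \<open>Q \<noteq> 0\<close> by (rule card_poly_roots_bound)
  also have "\<dots> \<le> max (degree (A p)) (degree (smult C (A q)))"
    unfolding Q_def by (rule degree_diff_le_max)
  also have "\<dots> \<le> (\<Sum>j\<in>J. p j) + (\<Sum>j\<in>J. q j)"
    using deg_A[of p] deg_A[of q] degree_smult_le[of C "A q"] by linarith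
  finally show "card Z \<le> (\<Sum>j\<in>J. p j + q j)" by (simp add: sum.distrib)
qed

lemma card_states:
  fixes u :: "'j \<Rightarrow> complex" and p q :: "'j \<Rightarrow> nat" and M :: nat
  assumes J: "finite J" "J \<noteq> {}" and inj: "inj_on u J" and "y0 \<noteq> 0" and "C \<noteq> 0"
    and pq: "\<And>j. j \<in> J \<Longrightarrow> (p j = 0) \<noteq> (q j = 0)"
  defines "Z \<equiv> {(y, w). y ^ 2 = y0 ^ 2 \<and>
      (\<Prod>j\<in>J. (w - u j * y) ^ p j) = C * y ^ M * (\<Prod>j\<in>J. (w - u j * y) ^ q j)}"
  shows "finite Z" and "card Z \<le> 2 * (\<Sum>j\<in>J. p j + q j)"
proof -
  define L where "L y = {w. (\<Prod>j\<in>J. (w - u j * y) ^ p j)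
      = C * y ^ M * (\<Prod>j\<in>J. (w - u j * y) ^ q j)}" for y
  have L: "finite (L y)" "card (L y) \<le> (\<Sum>j\<in>J. p j + q j)" if "y \<noteq> 0" for y
    unfolding L_def using card_level_set[OF J inj that _ pq, of "C * y ^ M"] that \<open>C \<noteq> 0\<close> by auto
  have Z: "Z = Pair y0 ` L y0 \<union> Pair (- y0) ` L (- y0)"
    by (auto simp: Z_def L_def power2_eq_iff)
  show "finite Z" unfolding Z using L \<open>y0 \<noteq> 0\<close> by simp
  have "card Z \<le> card (L y0) + card (L (- y0))"
    unfolding Z by (rule order.trans[OF card_Un_le]) (use L \<open>y0 \<noteq> 0\<close> in \<open>auto intro!: add_mono card_image_le\<close>)
  also have "\<dots> \<le> 2 * (\<Sum>j\<in>J. p j + q j)"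
    using L(2)[of y0] L(2)[of "- y0"] \<open>y0 \<noteq> 0\<close> by simp
  finally show "card Z \<le> 2 * (\<Sum>j\<in>J. p j + q j)" .
qed

lemma recurrence:
  fixes f :: "nat \<Rightarrow> 'a"
  assumes "finite Z" and "card Z \<le> D" and "\<And>k. f k \<in> Z"
  shows "\<exists>i d. 0 < d \<and> d \<le> D \<and> f (i + d) = f i"
proof -
  have "card (f ` {..D}) \<le> card Z"
    using assms by (intro card_mono) auto
  then have "\<not> inj_on f {..D}"
    using assms(2) by (intro pigeonhole) simp
  then obtain i j where "i < j" "j \<le> D" "f j = f i"
    unfolding inj_on_def by (metis atMost_iff linorder_neqE_nat)
  then have "0 < j - i \<and> j - i \<le> D \<and> f (i + (j - i)) = f i" by simp
  then show ?thesis by blast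
qed

section \<open>Partial fractions and rational residues\<close>

text \<open>
  Vieta's formulas in homogeneous form: \<open>u\<^sup>3 + g\<^sub>1 u\<^sup>2 + g\<^sub>2 u + g\<^sub>3 = u + \<Prod>\<^sub>l (u - u\<^sub>l)\<close>, multiplied by \<open>y\<^sup>3\<close>
  for \<open>w = u y\<close>. They follow by forming divided differences of the three equations for the roots.
\<close>

lemma cubic_vieta:
  fixes g1 g2 g3 :: complex
  assumes "{z. z ^ 3 + g1 * z ^ 2 + (g2 - 1) * z + g3 = 0} = {u 1, u 2, u (3::nat)}"
    and "u 1 \<noteq> u 2" and "u 1 \<noteq> u 3" and "u 2 \<noteq> u 3"
  shows "w ^ 3 + g1 * y * w ^ 2 + g2 * y ^ 2 * w + g3 * y ^ 3
    = y ^ 2 * w + (\<Prod>l\<in>{1, 2, 3}. w - u l * y)"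
proof -
  define u1 u2 u3 where "u1 = u 1" and "u2 = u 2" and "u3 = u 3"
  note u_defs = u1_def u2_def u3_def
  have r: "u1 ^ 3 + g1 * u1 ^ 2 + (g2 - 1) * u1 + g3 = 0"
    "u2 ^ 3 + g1 * u2 ^ 2 + (g2 - 1) * u2 + g3 = 0"
    "u3 ^ 3 + g1 * u3 ^ 2 + (g2 - 1) * u3 + g3 = 0"
    using assms(1) unfolding u_defs by auto
  have "(u1 - u2) * (u1 ^ 2 + u1 * u2 + u2 ^ 2 + g1 * (u1 + u2) + (g2 - 1)) = 0"
    using r(1,2) by algebra
  then have 12: "u1 ^ 2 + u1 * u2 + u2 ^ 2 + g1 * (u1 + u2) + (g2 - 1) = 0"
    using assms(2) by (simp add: u_defs)
  have "(u1 - u3) * (u1 ^ 2 + u1 * u3 + u3 ^ 2 + g1 * (u1 + u3) + (g2 - 1)) = 0"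
    using r(1,3) by algebra
  then have 13: "u1 ^ 2 + u1 * u3 + u3 ^ 2 + g1 * (u1 + u3) + (g2 - 1) = 0"
    using assms(3) by (simp add: u_defs)
  have "(u2 - u3) * (u1 + u2 + u3 + g1) = 0"
    using 12 13 by algebra
  then have "u1 + u2 + u3 + g1 = 0"
    using assms(4) by (simp add: u_defs)
  then have g1: "g1 = - (u1 + u2 + u3)" by algebra
  then have g2: "g2 = 1 + u1 * u2 + u1 * u3 + u2 * u3" using 12 by algebra
  then have g3: "g3 = - (u1 * u2 * u3)" using r(1) g1 by algebra
  have "(\<Prod>l\<in>{1, 2, 3}. w - u l * y) = (w - u1 * y) * (w - u2 * y) * (w - u3 * y)"
    by (simp add: u_defs)
  then show ?thesis unfolding g1 g2 g3
    by (simp add: algebra_simps power2_eq_square power3_eq_cube)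
qed

text \<open>
  The second identity is the Lagrange interpolation of the constant 1 at the nodes \<open>u\<^sub>j\<close>, made
  homogeneous; the first compares coefficients of \<open>w\<^sup>2\<close> in it.
\<close>

lemma lagrange_three:
  fixes u :: "nat \<Rightarrow> complex"
  assumes "u 1 \<noteq> u 2" and "u 1 \<noteq> u 3" and "u 2 \<noteq> u 3"
  defines "res \<equiv> \<lambda>j. inverse (\<Prod>l\<in>{1, 2, 3} - {j}. u j - u l)"
  shows "(\<Sum>j\<in>{1, 2, 3}. res j) = 0"
    and "(\<Sum>j\<in>{1, 2, 3}. res j * (\<Prod>l\<in>{1, 2, 3} - {j}. w - u l * y)) = y ^ 2"
proof -
  define u1 u2 u3 where "u1 = u 1" and "u2 = u 2" and "u3 = u 3"
  define L where "L = inverse ((u1 - u2) * (u2 - u3) * (u3 - u1))"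
  have L: "L * ((u1 - u2) * (u2 - u3) * (u3 - u1)) = 1"
    unfolding L_def by (rule left_inverse) (use assms(1-3) in \<open>auto simp: u1_def u2_def u3_def\<close>)
  have sets: "{1, 2, 3} - {1::nat} = {2, 3}" "{1, 2, 3} - {2::nat} = {1, 3}"
      "{1, 2, 3} - {3::nat} = {1, 2}"
    by auto
  have "res 1 = inverse ((u1 - u2) * (u1 - u3))" "res 2 = inverse ((u2 - u1) * (u2 - u3))"
      "res 3 = inverse ((u3 - u1) * (u3 - u2))"
    unfolding res_def sets u1_def u2_def u3_def by simp_all
  moreover have "inverse ((u1 - u2) * (u1 - u3)) = - L * (u2 - u3)"
    by (rule inverse_unique) (use L in algebra)
  moreover have "inverse ((u2 - u1) * (u2 - u3)) = - L * (u3 - u1)"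
    by (rule inverse_unique) (use L in algebra)
  moreover have "inverse ((u3 - u1) * (u3 - u2)) = - L * (u1 - u2)"
    by (rule inverse_unique) (use L in algebra)
  ultimately have res: "res 1 = - L * (u2 - u3)" "res 2 = - L * (u3 - u1)" "res 3 = - L * (u1 - u2)"
    by simp_all
  show "(\<Sum>j\<in>{1, 2, 3}. res j) = 0"
    by (simp add: res[unfolded One_nat_def] algebra_simps)
  have "(\<Sum>j\<in>{1, 2, 3}. res j * (\<Prod>l\<in>{1, 2, 3} - {j}. w - u l * y))
      = res 1 * ((w - u2 * y) * (w - u3 * y)) + res 2 * ((w - u1 * y) * (w - u3 * y))
        + res 3 * ((w - u1 * y) * (w - u2 * y))"
    by (simp add: sets[unfolded One_nat_def] u1_def u2_def u3_def)
  also have "\<dots> = L * ((u1 - u2) * (u2 - u3) * (u3 - u1)) * y ^ 2"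
    unfolding res by algebra
  also have "\<dots> = y ^ 2" by (simp only: L mult_1)
  finally show "(\<Sum>j\<in>{1, 2, 3}. res j * (\<Prod>l\<in>{1, 2, 3} - {j}. w - u l * y)) = y ^ 2" .
qed

lemma common_denominator:
  fixes r :: "'j \<Rightarrow> complex"
  assumes "finite J" and "\<And>j. j \<in> J \<Longrightarrow> r j \<in> \<rat>"
  shows "\<exists>M>0. \<exists>m :: 'j \<Rightarrow> int. \<forall>j\<in>J. of_nat M * r j = of_int (m j)"
proof -
  have "\<forall>j\<in>J. \<exists>n m. n > (0::nat) \<and> of_nat n * r j = of_int m"
  proof
    fix j assume "j \<in> J"
    then obtain a b :: int where "b > 0" "r j = of_int a / of_int b"
      using assms(2) Rats_cases' by metis
    then have "nat b > 0 \<and> of_nat (nat b) * r j = of_int a" by (simp add: field_simps)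
    then show "\<exists>n m. n > (0::nat) \<and> of_nat n * r j = of_int m" by blast
  qed
  then obtain n m where nm: "\<And>j. j \<in> J \<Longrightarrow> n j > (0::nat) \<and> of_nat (n j) * r j = of_int (m j)"
    by metis
  let ?M = "\<Prod>j\<in>J. n j"
  have "of_nat ?M * r j = of_int (int (\<Prod>i\<in>J - {j}. n i) * m j)" if "j \<in> J" for j
    using nm[OF that] by (simp add: prod.remove[OF assms(1) that] mult_ac flip: of_nat_prod)
  moreover have "?M > 0" using nm by (simp add: prod_pos)
  ultimately show ?thesis by (intro exI[of _ ?M]) (auto intro!: exI[of _ "\<lambda>j. int (\<Prod>i\<in>J - {j}. n i) * m j"])
qed

section \<open>Periodicity\<close>

lemma is_solution_y:
  assumes "a 1 * b 2 - a 2 * b 1 \<noteq> 0" and "is_solution (coef a b \<gamma>) \<omega> \<xi> x"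
  defines "y \<equiv> \<lambda>t. a 1 * x 1 t + a 2 * x 2 t"
  shows "(y has_vector_derivative \<i> * of_real \<omega> * y t + y t ^ 3) (at t)"
proof -
  have "(y has_vector_derivative
      a 1 * (\<i> * of_real \<omega> * x 1 t + cubic (coef a b \<gamma>) 1 (x 1 t) (x 2 t))
      + a 2 * (\<i> * of_real \<omega> * x 2 t + cubic (coef a b \<gamma>) 2 (x 1 t) (x 2 t))) (at t)"
    using assms(2) unfolding is_solution_def y_def by (auto intro!: derivative_eq_intros)
  then show ?thesis
    by (rule back_subst[of "\<lambda>d. (y has_vector_derivative d) (at t)"])
      (use cubic_coef_y[OF assms(1), of \<gamma> "x 1 t" "x 2 t"] in \<open>simp add: y_def algebra_simps\<close>)
qed

lemma is_solution_w:
  assumes "a 1 * b 2 - a 2 * b 1 \<noteq> 0" and "is_solution (coef a b \<gamma>) \<omega> \<xi> x"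
  defines "y \<equiv> \<lambda>t. a 1 * x 1 t + a 2 * x 2 t" and "w \<equiv> \<lambda>t. b 1 * x 1 t + b 2 * x 2 t"
  shows "(w has_vector_derivative \<i> * of_real \<omega> * w t
    + (w t ^ 3 + \<gamma> 1 * y t * w t ^ 2 + \<gamma> 2 * y t ^ 2 * w t + \<gamma> 3 * y t ^ 3)) (at t)"
proof -
  have "(w has_vector_derivative
      b 1 * (\<i> * of_real \<omega> * x 1 t + cubic (coef a b \<gamma>) 1 (x 1 t) (x 2 t))
      + b 2 * (\<i> * of_real \<omega> * x 2 t + cubic (coef a b \<gamma>) 2 (x 1 t) (x 2 t))) (at t)"
    using assms(2) unfolding is_solution_def w_def by (auto intro!: derivative_eq_intros)
  then show ?thesis
    by (rule back_subst[of "\<lambda>d. (w has_vector_derivative d) (at t)"])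
      (use cubic_coef_w[OF assms(1), of "y t" "x 1 t" "x 2 t" "w t" \<gamma>]
        in \<open>simp add: y_def w_def algebra_simps\<close>)
qed

lemma periodic_multiple:
  fixes f :: "real \<Rightarrow> 'a"
  assumes "\<And>t. f (t + h) = f t"
  shows "f (t + real n * h) = f t"
proof (induction n)
  case (Suc n)
  have "f (t + real (Suc n) * h) = f ((t + real n * h) + h)" by (simp add: algebra_simps)
  then show ?case using assms Suc by simp
qed simp

lemma exp_full_turns:
  fixes \<omega> :: real
  assumes "\<omega> \<noteq> 0"
  shows "exp (of_nat m * (\<i> * of_real \<omega>) * of_real (real k * (2 * pi / \<bar>\<omega>\<bar>))) = 1"
proof -
  define s :: int where "s = (if \<omega> > 0 then 1 else -1)"
  have "of_nat m * (\<i> * of_real \<omega>) * of_real (real k * (2 * pi / \<bar>\<omega>\<bar>))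
      = of_real (2 * of_int (of_nat m * of_nat k * s) * pi) * \<i>"
    using assms by (cases "\<omega> > 0") (simp_all add: s_def field_simps)
  then show ?thesis by (simp only: exp_integer_2pi[OF Ints_of_int])
qed

text \<open>
  The period depends only on the exponents \<open>p\<close> and \<open>q\<close>: two states coincide after
  some \<open>d\<close> turns that varies with the initial data, but \<open>d\<close> is at most the bound \<open>D\<close> on the number of
  states, so it divides \<open>D!\<close>.
\<close>

lemma solution_periodic:
  fixes a b \<gamma> u :: "nat \<Rightarrow> complex" and \<omega> :: real
  assumes c: "a 1 * b 2 - a 2 * b 1 \<noteq> 0"
    and roots: "{z. z ^ 3 + \<gamma> 1 * z ^ 2 + (\<gamma> 2 - 1) * z + \<gamma> 3 = 0} = {u 1, u 2, u 3}"
    and u: "u 1 \<noteq> u 2" "u 1 \<noteq> u 3" "u 2 \<noteq> u 3"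
    and \<omega>: "\<omega> \<noteq> 0"
    and pq: "\<And>j. j \<in> {1, 2, 3} \<Longrightarrow> (p j = 0) \<noteq> (q j = (0::nat))"
    and res: "\<And>j. j \<in> {1, 2, 3} \<Longrightarrow>
      of_nat M * inverse (\<Prod>l\<in>{1, 2, 3} - {j}. u j - u l) = of_nat (p j) - of_nat (q j)"
    and sol: "is_solution (coef a b \<gamma>) \<omega> \<xi> x"
    and y0: "a 1 * \<xi> 1 + a 2 * \<xi> 2 \<noteq> 0"
    and v0: "\<And>j. j \<in> {1, 2, 3} \<Longrightarrow>
      b 1 * \<xi> 1 + b 2 * \<xi> 2 \<noteq> u j * (a 1 * \<xi> 1 + a 2 * \<xi> 2)"
    and n: "n \<in> {1, 2}"
  shows "x n (t + real (fact (2 * (\<Sum>j\<in>{1, 2, 3}. p j + q j))) * (2 * pi / \<bar>\<omega>\<bar>)) = x n t"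
proof -
  define J where "J = {1, 2, 3::nat}"
  define T where "T = 2 * pi / \<bar>\<omega>\<bar>"
  define D where "D = 2 * (\<Sum>j\<in>J. p j + q j)"
  define y where "y t = a 1 * x 1 t + a 2 * x 2 t" for t
  define w where "w t = b 1 * x 1 t + b 2 * x 2 t" for t
  have J: "finite J" "J \<noteq> {}" and inj: "inj_on u J"
    using u by (auto simp: J_def)
  have x0: "x 1 0 = \<xi> 1" "x 2 0 = \<xi> 2" using sol by (auto simp: is_solution_def)
  have y_0: "y 0 \<noteq> 0" using y0 unfolding y_def x0 .
  have v_0: "w 0 - u j * y 0 \<noteq> 0" if "j \<in> J" for j
    using v0[of j] that unfolding J_def y_def w_def x0 by simp
  have dy: "(y has_vector_derivative \<i> * of_real \<omega> * y t + y t ^ 3) (at t)" for t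
    using is_solution_y[OF c sol] by (simp add: y_def[abs_def])
  have dw: "(w has_vector_derivative \<i> * of_real \<omega> * w t
    + (w t ^ 3 + \<gamma> 1 * y t * w t ^ 2 + \<gamma> 2 * y t ^ 2 * w t + \<gamma> 3 * y t ^ 3)) (at t)" for t
    using is_solution_w[OF c sol] by (simp add: y_def[abs_def] w_def[abs_def])
  have dw': "(w has_vector_derivative \<i> * of_real \<omega> * w t
      + (y t ^ 2 * w t + (\<Prod>l\<in>J. w t - u l * y t))) (at t)" for t
    using dw[of t] unfolding cubic_vieta[OF roots u] J_def .
  have sum0: "(\<Sum>j\<in>J. of_nat (p j) - of_nat (q j)) = (0::complex)"
  proof -
    have "(\<Sum>j\<in>J. of_nat (p j) - of_nat (q j))
        = of_nat M * (\<Sum>j\<in>J. inverse (\<Prod>l\<in>J - {j}. u j - u l))"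
      unfolding sum_distrib_left by (rule sum.cong) (use res in \<open>simp_all add: J_def\<close>)
    also have "\<dots> = 0" unfolding J_def lagrange_three(1)[OF u] by simp
    finally show ?thesis .
  qed
  have lagrange: "(\<Sum>j\<in>J. (of_nat (p j) - of_nat (q j)) * (\<Prod>l\<in>J - {j}. W - u l * Y))
        = of_nat M * Y ^ 2" for Y W
  proof -
    have "(\<Sum>j\<in>J. (of_nat (p j) - of_nat (q j)) * (\<Prod>l\<in>J - {j}. W - u l * Y))
        = of_nat M * (\<Sum>j\<in>J. inverse (\<Prod>l\<in>J - {j}. u j - u l) * (\<Prod>l\<in>J - {j}. W - u l * Y))"
      unfolding sum_distrib_left mult.assoc[symmetric]
      by (rule sum.cong) (use res in \<open>simp_all only: J_def\<close>)
    also have "\<dots> = of_nat M * Y ^ 2" unfolding J_def lagrange_three(2)[OF u] ..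
    finally show ?thesis .
  qed
  define A where "A r t = (\<Prod>j\<in>J. (w t - u j * y t) ^ r j)" for r t
  define C where "C = A p 0 / (A q 0 * y 0 ^ M)"
  have A0: "A r 0 \<noteq> 0" for r using v_0 J by (simp add: A_def)
  then have C: "C \<noteq> 0" using y_0 by (simp add: C_def)
  define Z where "Z = {(Y, W). Y ^ 2 = y 0 ^ 2 \<and>
      (\<Prod>j\<in>J. (W - u j * Y) ^ p j) = C * Y ^ M * (\<Prod>j\<in>J. (W - u j * Y) ^ q j)}"
  have Z: "finite Z" "card Z \<le> D"
    unfolding Z_def D_def by (rule card_states[OF J inj y_0 C]; use pq in \<open>simp add: J_def\<close>)+
  have "(y (real k * T), w (real k * T)) \<in> Z" for k
  proof -
    let ?t = "real k * T"
    have e: "exp (2 * \<i> * of_real \<omega> * of_real ?t) = 1"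
      using exp_full_turns[OF \<omega>, of 2 k] by (simp add: T_def mult.assoc)
    have "tau \<omega> ?t = 0" unfolding tau_def e by simp
    then have "y ?t ^ 2 * (1 / y 0 ^ 2) = 1"
      using y_first_integral[OF \<omega> dy y_0, of ?t] unfolding e by simp
    then have y2: "y ?t ^ 2 = y 0 ^ 2" using y_0 by (simp add: field_simps)
    have "A q 0 * y 0 ^ M * A p ?t = A p 0 * (A q ?t * y ?t ^ M)"
      using root_product_first_integral[OF J(1) dy dw' sum0 lagrange, of ?t]
      unfolding A_def T_def exp_full_turns[OF \<omega>] by simp
    then have "A p ?t = C * y ?t ^ M * A q ?t"
      using A0[of q] y_0 by (simp add: C_def field_simps)
    with y2 show ?thesis by (simp add: Z_def A_def)
  qed
  from recurrence[OF Z, of "\<lambda>k. (y (real k * T), w (real k * T))", OF this]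
  obtain i d where d: "0 < d" "d \<le> D"
    and eq: "y (real (i + d) * T) = y (real i * T)" "w (real (i + d) * T) = w (real i * T)"
    by auto
  define h where "h = real d * T"
  have yw: "y (t + h) = y t" "w (t + h) = w t" for t
    by (rule triangular_unique[OF has_vector_derivative_shift[OF dy] dy
          has_vector_derivative_shift[OF dw] dw, of "real i * T"];
        use eq in \<open>simp add: h_def algebra_simps\<close>)+
  have x_yw: "x 1 t = (b 2 * y t - a 2 * w t) / (a 1 * b 2 - a 2 * b 1)"
    "x 2 t = (a 1 * w t - b 1 * y t) / (a 1 * b 2 - a 2 * b 1)" for t
    using c by (simp_all add: y_def w_def field_simps)
  have xh: "x n (t + h) = x n t" for t
    using n x_yw yw by auto
  have "d dvd fact D" using d by (intro dvd_fact) auto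
  then obtain m where m: "fact D = d * m" by (rule dvdE)
  have "real (fact D) * T = real m * h" unfolding m h_def by simp
  then show ?thesis
    using periodic_multiple[of "x n" h t m, OF xh] by (simp add: D_def J_def T_def)
qed

theorem mainTheorem3:
  fixes a b \<gamma> u :: "nat \<Rightarrow> complex" and \<omega> :: real
  assumes "a 1 * b 2 - a 2 * b 1 \<noteq> 0"
    and "{z. z ^ 3 + \<gamma> 1 * z ^ 2 + (\<gamma> 2 - 1) * z + \<gamma> 3 = 0} = {u 1, u 2, u 3}"
    and "u 1 \<noteq> u 2" and "u 1 \<noteq> u 3" and "u 2 \<noteq> u 3"
    and "\<forall>j\<in>{1, 2, 3}. inverse (\<Prod>l\<in>{1, 2, 3} - {j}. u j - u l) \<in> \<rat>"
    and "\<omega> \<noteq> 0"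
  shows "\<exists>N::nat. N > 0 \<and>
    (\<forall>\<xi>. generic_data a b \<gamma> u \<omega> \<xi> \<longrightarrow>
      (\<exists>x. is_solution (coef a b \<gamma>) \<omega> \<xi> x) \<and>
      (\<forall>x. is_solution (coef a b \<gamma>) \<omega> \<xi> x \<longrightarrow>
        (\<forall>n\<in>{1, 2}. \<forall>t. x n (t + real N * (2 * pi / \<bar>\<omega>\<bar>)) = x n t)))"
proof -
  let ?res = "\<lambda>j. inverse (\<Prod>l\<in>{1, 2, 3} - {j}. u j - u l)"
  have "\<exists>M>0. \<exists>m :: nat \<Rightarrow> int. \<forall>j\<in>{1, 2, 3}. of_nat M * ?res j = of_int (m j)"
    by (rule common_denominator) (simp, use assms(6) in blast)
  then obtain M and m :: "nat \<Rightarrow> int"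
    where "M > 0" and M: "\<forall>j\<in>{1, 2, 3}. of_nat M * ?res j = of_int (m j)"
    by blast
  \<comment> \<open>Positive and negative parts of the integers \<open>M \<lambda>\<^sub>j\<close>, of which exactly one is nonzero.\<close>
  define p where "p j = nat (m j)" for j
  define q where "q j = nat (- m j)" for j
  have res: "of_nat M * ?res j = of_nat (p j) - of_nat (q j)" if "j \<in> {1, 2, 3}" for j
  proof -
    have "of_nat (p j) - of_nat (q j) = (of_int (m j) :: complex)"
      by (cases "m j \<ge> 0") (simp_all add: p_def q_def)
    then show ?thesis using bspec[OF M that] by (simp only:)
  qed
  have pq: "(p j = 0) \<noteq> (q j = 0)" if "j \<in> {1, 2, 3}" for j
  proof -
    have "?res j \<noteq> 0" using assms(3-5) that by auto
    then have "m j \<noteq> 0" using \<open>M > 0\<close> bspec[OF M that] by (metis mult_eq_0_iff of_int_0 of_nat_eq_0_iff less_irrefl)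
    then show ?thesis by (auto simp: p_def q_def)
  qed
  define N :: nat where "N = fact (2 * (\<Sum>j\<in>{1, 2, 3}. p j + q j))"
  show ?thesis
  proof (intro exI[of _ N] conjI allI impI ballI)
    show "N > 0" by (simp add: N_def)
  next
    fix \<xi> assume "generic_data a b \<gamma> u \<omega> \<xi>"
    then show "\<exists>x. is_solution (coef a b \<gamma>) \<omega> \<xi> x"
      unfolding generic_data_def Let_def using continuation_is_solution[OF assms(7)] by blast
  next
    fix \<xi> x n t
    assume gen: "generic_data a b \<gamma> u \<omega> \<xi>" and sol: "is_solution (coef a b \<gamma>) \<omega> \<xi> x"
      and n: "n \<in> {1, 2::nat}"
    have y0: "a 1 * \<xi> 1 + a 2 * \<xi> 2 \<noteq> 0"
      and "(b 1 * \<xi> 1 + b 2 * \<xi> 2) / (a 1 * \<xi> 1 + a 2 * \<xi> 2) \<notin> {u 1, u 2, u 3}"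
      using gen by (simp_all add: generic_data_def Let_def)
    then have v0: "b 1 * \<xi> 1 + b 2 * \<xi> 2 \<noteq> u j * (a 1 * \<xi> 1 + a 2 * \<xi> 2)"
      if "j \<in> {1, 2, 3}" for j
      using that by auto
    show "x n (t + real N * (2 * pi / \<bar>\<omega>\<bar>)) = x n t"
      unfolding N_def
      by (rule solution_periodic[OF assms(1-5,7) pq res sol y0 v0 n])
  qed
qed
end
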